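(* Let $\mathbb{K}=\mathbb{R}_+^{n_1}\times\prod_{h=2}^N\mathbb{L}^{n_h}\subseteq\mathbb{R}^n$, $n=\sum_{h=1}^N n_h$, be a direct product of a nonnegative orthant and second-order cones. Then $\mathcal{DNN}_{\rm NN}(\mathbb{K})\subseteq\mathcal{DNN}_{\rm ZVP}(\mathbb{K})$. Moreover, the inclusion is strict if $n_1\ge 1$ and $n_2\ge 2$ (so in particular $N\ge 2$).
   Context: $\mathbb{N}$ is the set of nonnegative integers; $\mathbb{S}^n$ is the space of real symmetric $n\times n$ matrices with inner product $\langle X,Y\rangle=\sum_{i,j}X_{i,j}Y_{i,j}$; $\mathbb{R}_+^{m}$ is the nonnegative orthant. For a cone $\mathcal{K}\subseteq\mathbb{S}^n$, $\mathcal{K}^*=\{X\in\mathbb{S}^n\mid\langle X,Y\rangle\ge0\ \forall Y\in\mathcal{K}\}$. $\mathbb{L}^1=\mathbb{R}_+$ and $\mathbb{L}^m=\{x\in\mathbb{R}^m\mid x_1\ge\|(x_2,\dots,x_m)\|\}$ (Euclidean norm) for $m\ge2$. $H^{n,m}$ is the set of real homogeneous polynomials in $n$ variables of degree $m$ (with $H^{n,0}$ the constants), and $\Sigma^{n,4}=\operatorname{conv}\{\theta^2\mid\theta\in H^{n,2}\}$. Indexing: $N\ge1$, $n_1\ge0$, $n_h\ge1$ for $h=2,\dots,N$, $n\ge 1$. Coordinates of $x\in\mathbb{R}^n$ are reindexed by $hi:=\sum_{k=1}^{h-1}n_k+i$ ($1\le h\le N$, $1\le i\le n_h$). Let $\mathcal{I}_h=\{h1,\dots,hn_h\}$,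 $\mathcal{I}_h^-=\mathcal{I}_h\setminus\{h1\}$ for $h\ge2$, and $\mathcal{I}_{\ge0}=\mathcal{I}_1\cup\{21,31,\dots,N1\}$. ZVP-type cone: $\mathbb{K}$ is described as the set of $x\in\mathbb{R}^n$ at which the following homogeneous polynomials $\phi_1,\dots,\phi_q$ (of degrees $m_1,\dots,m_q$) are all nonnegative: $x_I$ ($I\in\mathcal{I}_{\ge0}$); $\sum_{I\in\mathcal{I}_{\ge0}}x_I$; and $x_{h1}^2-\sum_{I\in\mathcal{I}_h^-}x_I^2$ ($h=2,\dots,N$). Let $E^{n,2}(\mathbb{K})$ be the convex hull of the set of all polynomials $\psi^2\prod_{j=1}^k\phi_{i_j}$ with $k\in\mathbb{N}$, $i_j\in\{1,\dots,q\}$, $2-\sum_{j=1}^km_{i_j}$ a nonnegative even integer, and $\psi\in H^{n,(2-\sum_j m_{i_j})/2}$. Let $\mathcal{K}_{{\rm ZVP},0}(\mathbb{K})=\{A\in\mathbb{S}^n\mid x^\top Ax\in E^{n,2}(\mathbb{K})\}$ and $\mathcal{DNN}_{\rm ZVP}(\mathbb{K})=\mathcal{K}_{{\rm ZVP},0}(\mathbb{K})^*$. NN-type cone: for $x\in\mathbb{R}^n$, let $x\circ x\in\mathbb{R}^n$ be the vector with $(x\circ x)_I=x_I^2$ for $I\in\mathcal{I}_1$, $(x\circ x)_{h1}=\sum_{I\in\mathcal{I}_h}x_I^2$ and $(x\circ x)_I=2x_{h1}x_I$ for $I\in\mathcal{I}_h^-$, $h=2,\dots,N$. Let $\mathcal{K}_{{\rm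 NN},0}(\mathbb{K})=\{A\in\mathbb{S}^n\mid(x\circ x)^\top A(x\circ x)\in\Sigma^{n,4}\}$ and $\mathcal{DNN}_{\rm NN}(\mathbb{K})=\mathcal{K}_{{\rm NN},0}(\mathbb{K})^*$. *)

theory Defs
  imports "HOL-Analysis.Convex" "HOL-Analysis.Finite_Function_Topology" "Jordan_Normal_Form.Matrix"
begin

text \<open>
  Conventions. Everything is indexed from 0: the variables are \<open>X 0, \<dots>, X (n - 1)\<close>, and an
  index \<open>hi\<close> (with \<open>1 \<le> i \<le> d h\<close>) is the position \<open>offset d h + (i - 1)\<close>. Block numbers
  \<open>h\<close> run over \<open>1, \<dots>, N\<close>, and \<open>d h\<close> is the dimension of block \<open>h\<close>.
\<close>

section \<open>Real polynomials\<close>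

text \<open>
  A polynomial maps each exponent vector to its coefficient. The ring structure is that of
  \<open>HOL-Library.Poly_Mapping\<close>, the real vector space structure (scalar multiplication, convex hull)
  that of \<open>HOL-Analysis.Finite_Function_Topology\<close>.
\<close>

type_synonym real_mpoly = "(nat \<Rightarrow>\<^sub>0 nat) \<Rightarrow>\<^sub>0 real"

definition X :: "nat \<Rightarrow> real_mpoly" where
  "X i = Poly_Mapping.single (Poly_Mapping.single i 1) 1"

text \<open>\<open>Hom n m\<close> is $H^{n,m}$; it contains the zero polynomial for every \<open>m\<close>.\<close>

definition Hom :: "nat \<Rightarrow> nat \<Rightarrow> real_mpoly set" where
  "Hom n m = {p. \<forall>\<alpha> \<in> Poly_Mapping.keys p.
     Poly_Mapping.keys \<alpha> \<subseteq> {..<n} \<and> (\<Sum>i\<in>Poly_Mapping.keys \<alpha>. Poly_Mapping.lookup \<alpha> i) = m}"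

definition eval_mpoly :: "real_mpoly \<Rightarrow> real vec \<Rightarrow> real" where
  "eval_mpoly p x = (\<Sum>\<alpha>\<in>Poly_Mapping.keys p.
     Poly_Mapping.lookup p \<alpha> * (\<Prod>i\<in>Poly_Mapping.keys \<alpha>. (x $ i) ^ Poly_Mapping.lookup \<alpha> i))"

definition Sigma4 :: "nat \<Rightarrow> real_mpoly set" where
  "Sigma4 n = convex hull {\<theta>\<^sup>2 | \<theta>. \<theta> \<in> Hom n 2}"

text \<open>The polynomial \<open>v\<^sup>T A v\<close> for a vector \<open>v\<close> of polynomials.\<close>

definition quad_form :: "nat \<Rightarrow> real mat \<Rightarrow> (nat \<Rightarrow> real_mpoly) \<Rightarrow> real_mpoly" where
  "quad_form n A v = (\<Sum>i<n. \<Sum>j<n. (A $$ (i, j)) *\<^sub>R (v i * v j))"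


section \<open>Symmetric matrices and dual cones\<close>

definition sym_mats :: "nat \<Rightarrow> real mat set" where
  "sym_mats n = {A \<in> carrier_mat n n. transpose_mat A = A}"

definition mat_inner :: "nat \<Rightarrow> real mat \<Rightarrow> real mat \<Rightarrow> real" where
  "mat_inner n A B = (\<Sum>i<n. \<Sum>j<n. A $$ (i, j) * B $$ (i, j))"

definition dual_cone :: "nat \<Rightarrow> real mat set \<Rightarrow> real mat set" where
  "dual_cone n C = {A \<in> sym_mats n. \<forall>B\<in>C. mat_inner n A B \<ge> 0}"


section \<open>The cone and its index sets\<close>

definition offset :: "(nat \<Rightarrow> nat) \<Rightarrow> nat \<Rightarrow> nat" where
  "offset d h = (\<Sum>k=1..<h. d k)"

definition total_dim :: "nat \<Rightarrow> (nat \<Rightarrow> nat) \<Rightarrow> nat" where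
  "total_dim N d = (\<Sum>h=1..N. d h)"

text \<open>$\mathcal{I}_h$, $\mathcal{I}_h^-$ and $\mathcal{I}_{\ge 0}$; the index \<open>h1\<close> is \<open>offset d h\<close>.\<close>

definition block :: "(nat \<Rightarrow> nat) \<Rightarrow> nat \<Rightarrow> nat set" where
  "block d h = {offset d h ..< offset d h + d h}"

definition block_tail :: "(nat \<Rightarrow> nat) \<Rightarrow> nat \<Rightarrow> nat set" where
  "block_tail d h = block d h - {offset d h}"

definition nonneg_idx :: "nat \<Rightarrow> (nat \<Rightarrow> nat) \<Rightarrow> nat set" where
  "nonneg_idx N d = block d 1 \<union> offset d ` {2..N}"

text \<open>For \<open>m = 1\<close> the sum is empty and this is the nonnegative half-line.\<close>

definition second_order_cone :: "nat \<Rightarrow> real vec set" where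
  "second_order_cone m = {x \<in> carrier_vec m. x $ 0 \<ge> sqrt (\<Sum>i=1..<m. (x $ i)\<^sup>2)}"

definition nonneg_orthant :: "nat \<Rightarrow> real vec set" where
  "nonneg_orthant m = {x \<in> carrier_vec m. \<forall>i<m. x $ i \<ge> 0}"

definition block_vec :: "(nat \<Rightarrow> nat) \<Rightarrow> nat \<Rightarrow> real vec \<Rightarrow> real vec" where
  "block_vec d h x = vec (d h) (\<lambda>i. x $ (offset d h + i))"

definition K_prod :: "nat \<Rightarrow> (nat \<Rightarrow> nat) \<Rightarrow> real vec set" where
  "K_prod N d = {x \<in> carrier_vec (total_dim N d).
     block_vec d 1 x \<in> nonneg_orthant (d 1) \<and>
     (\<forall>h\<in>{2..N}. block_vec d h x \<in> second_order_cone (d h))}"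

text \<open>
  The polynomials describing the cone (see \<open>K_prod_eq\<close> below), each paired with its degree.
\<close>

definition K_polys :: "nat \<Rightarrow> (nat \<Rightarrow> nat) \<Rightarrow> (real_mpoly \<times> nat) set" where
  "K_polys N d =
     {(X I, 1) | I. I \<in> nonneg_idx N d} \<union>
     {(\<Sum>I\<in>nonneg_idx N d. X I, 1)} \<union>
     {((X (offset d h))\<^sup>2 - (\<Sum>I\<in>block_tail d h. (X I)\<^sup>2), 2) | h. h \<in> {2..N}}"


section \<open>The ZVP-type cone\<close>

text \<open>
  The list \<open>ps\<close> plays the role of $(\phi_{i_1}, \dots, \phi_{i_k})$: repetitions and the empty list
  are allowed, and \<open>2 * e\<close> is the nonnegative even number $m - \sum_j m_{i_j}$.
\<close>

definition E_cone :: "nat \<Rightarrow> nat \<Rightarrow> (real_mpoly \<times> nat) set \<Rightarrow> real_mpoly set" where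
  "E_cone n m \<Phi> = convex hull
     {\<psi>\<^sup>2 * prod_list (map fst ps) | \<psi> ps e.
        set ps \<subseteq> \<Phi> \<and> sum_list (map snd ps) + 2 * e = m \<and> \<psi> \<in> Hom n e}"

definition K_ZVP0 :: "nat \<Rightarrow> (nat \<Rightarrow> nat) \<Rightarrow> real mat set" where
  "K_ZVP0 N d = {A \<in> sym_mats (total_dim N d).
     quad_form (total_dim N d) A X \<in> E_cone (total_dim N d) 2 (K_polys N d)}"

definition DNN_ZVP :: "nat \<Rightarrow> (nat \<Rightarrow> nat) \<Rightarrow> real mat set" where
  "DNN_ZVP N d = dual_cone (total_dim N d) (K_ZVP0 N d)"


section \<open>The NN-type cone\<close>

text \<open>The block containing position \<open>I\<close>; unique for \<open>I < total_dim N d\<close>, see \<open>block_of_eqI\<close>.\<close>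

definition block_of :: "nat \<Rightarrow> (nat \<Rightarrow> nat) \<Rightarrow> nat \<Rightarrow> nat" where
  "block_of N d I = (THE h. h \<in> {1..N} \<and> I \<in> block d h)"

text \<open>The entries of \<open>x \<circ> x\<close>, as polynomials in the coordinates of \<open>x\<close>.\<close>

definition circ_sq :: "nat \<Rightarrow> (nat \<Rightarrow> nat) \<Rightarrow> nat \<Rightarrow> real_mpoly" where
  "circ_sq N d I = (let h = block_of N d I in
     if h = 1 then (X I)\<^sup>2
     else if I = offset d h then (\<Sum>J\<in>block d h. (X J)\<^sup>2)
     else 2 * X (offset d h) * X I)"

definition K_NN0 :: "nat \<Rightarrow> (nat \<Rightarrow> nat) \<Rightarrow> real mat set" where
  "K_NN0 N d = {A \<in> sym_mats (total_dim N d).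
     quad_form (total_dim N d) A (circ_sq N d) \<in> Sigma4 (total_dim N d)}"

definition DNN_NN :: "nat \<Rightarrow> (nat \<Rightarrow> nat) \<Rightarrow> real mat set" where
  "DNN_NN N d = dual_cone (total_dim N d) (K_NN0 N d)"


section \<open>The polynomials do describe the cone\<close>

lemma offset_Suc: "1 \<le> h \<Longrightarrow> offset d (Suc h) = offset d h + d h"
  by (simp add: offset_def)

lemma offset_1 [simp]: "offset d (Suc 0) = 0"
  by (simp add: offset_def)

lemma offset_mono: "h \<le> h' \<Longrightarrow> offset d h \<le> offset d h'"
  unfolding offset_def by (rule sum_mono2) auto

lemma total_dim_offset: "total_dim N d = offset d (Suc N)"
  by (simp add: total_dim_def offset_def atLeastLessThanSuc_atLeastAtMost)

lemma block_subset: "1 \<le> h \<Longrightarrow> h \<le> N \<Longrightarrow> block d h \<subseteq> {..<total_dim N d}"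
  using offset_mono[of "Suc h" "Suc N" d]
  by (auto simp: block_def total_dim_offset offset_Suc)

lemma block_of_eqI:
  assumes "h \<in> {1..N}" "I \<in> block d h"
  shows "block_of N d I = h"
  unfolding block_of_def
proof (rule the_equality)
  fix h' assume h': "h' \<in> {1..N} \<and> I \<in> block d h'"
  have "\<not> h < h'"
    using offset_mono[of "Suc h" h' d] h' assms by (auto simp: block_def offset_Suc)
  moreover have "\<not> h' < h"
    using offset_mono[of "Suc h'" h d] h' assms by (auto simp: block_def offset_Suc)
  ultimately show "h' = h" by simp
qed (use assms in blast)

lemma blocks_cover: "(\<Union>h\<in>{1..N}. block d h) = {..<total_dim N d}"
proof (induction N)
  case (Suc N)
  have "block d (Suc N) = {total_dim N d ..< total_dim (Suc N) d}"
    by (simp add: block_def total_dim_offset offset_Suc)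
  moreover have "total_dim N d \<le> total_dim (Suc N) d"
    by (simp add: total_dim_def)
  moreover have "{1..Suc N} = insert (Suc N) {1..N}" by auto
  ultimately show ?case using Suc.IH by auto
qed (simp add: total_dim_def)

lemma nonneg_idx_less:
  assumes "N \<ge> 1" "\<And>h. h \<in> {2..N} \<Longrightarrow> d h \<ge> 1" "I \<in> nonneg_idx N d"
  shows "I < total_dim N d"
proof -
  have "offset d h < total_dim N d" if "h \<in> {2..N}" for h
  proof -
    have "offset d h \<in> block d h" using assms(2)[OF that] by (simp add: block_def)
    with block_subset[of h N d] that show ?thesis by auto
  qed
  then show ?thesis
    using assms(1,3) block_subset[of 1 N d] by (auto simp: nonneg_idx_def)
qed

lemma finite_nonneg_idx [simp]: "finite (nonneg_idx N d)"
  by (simp add: nonneg_idx_def block_def)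

lemma finite_block_tail [simp]: "finite (block_tail d h)"
  by (simp add: block_tail_def block_def)

lemma X_power2: "(X i)\<^sup>2 = Poly_Mapping.single (Poly_Mapping.single i 2) 1"
  by (simp add: X_def power2_eq_square mult_single numeral_2_eq_2 flip: single_add)

lemma Hom_0 [simp]: "0 \<in> Hom n m"
  by (simp add: Hom_def)

lemma Hom_add: "p \<in> Hom n m \<Longrightarrow> q \<in> Hom n m \<Longrightarrow> p + q \<in> Hom n m"
  using keys_add[of p q] by (auto simp: Hom_def)

lemma Hom_uminus: "p \<in> Hom n m \<Longrightarrow> - p \<in> Hom n m"
  by (auto simp: Hom_def in_keys_iff)

lemma Hom_sum: "(\<And>i. i \<in> S \<Longrightarrow> f i \<in> Hom n m) \<Longrightarrow> sum f S \<in> Hom n m"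
  by (induction S rule: infinite_finite_induct) (auto intro: Hom_add)

lemma Hom_X: "i < n \<Longrightarrow> X i \<in> Hom n 1"
  by (simp add: Hom_def X_def)

lemma Hom_X_power2: "i < n \<Longrightarrow> (X i)\<^sup>2 \<in> Hom n 2"
  by (simp add: Hom_def X_power2)

lemma K_polys_Hom:
  assumes "N \<ge> 1" "\<And>h. h \<in> {2..N} \<Longrightarrow> d h \<ge> 1" "(\<phi>, m) \<in> K_polys N d"
  shows "\<phi> \<in> Hom (total_dim N d) m"
proof -
  have "(X (offset d h))\<^sup>2 - (\<Sum>I\<in>block_tail d h. (X I)\<^sup>2) \<in> Hom (total_dim N d) 2"
    if h: "h \<in> {2..N}" for h
  proof -
    have "offset d h < total_dim N d"
      using nonneg_idx_less[of N d "offset d h"] assms(1,2) h by (auto simp: nonneg_idx_def)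
    moreover have "block_tail d h \<subseteq> {..<total_dim N d}"
      using block_subset[of h N d] h by (auto simp: block_tail_def)
    ultimately show ?thesis
      unfolding diff_conv_add_uminus
      by (intro Hom_add Hom_uminus Hom_sum Hom_X_power2) auto
  qed
  moreover have "X I \<in> Hom (total_dim N d) 1" if "I \<in> nonneg_idx N d" for I
    using nonneg_idx_less[of N d I] assms(1,2) that by (intro Hom_X) blast
  moreover from this have "(\<Sum>I\<in>nonneg_idx N d. X I) \<in> Hom (total_dim N d) 1"
    by (intro Hom_sum)
  ultimately show ?thesis using assms(3) by (auto simp: K_polys_def)
qed

lemma eval_mpoly_superset:
  assumes "finite S" "Poly_Mapping.keys p \<subseteq> S"
  shows "eval_mpoly p x = (\<Sum>\<alpha>\<in>S.
     Poly_Mapping.lookup p \<alpha> * (\<Prod>i\<in>Poly_Mapping.keys \<alpha>. (x $ i) ^ Poly_Mapping.lookup \<alpha> i))"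
  unfolding eval_mpoly_def using assms
  by (intro sum.mono_neutral_left) (auto simp: in_keys_iff)

lemma eval_mpoly_0 [simp]: "eval_mpoly 0 x = 0"
  by (simp add: eval_mpoly_def)

lemma eval_mpoly_add: "eval_mpoly (p + q) x = eval_mpoly p x + eval_mpoly q x"
  using keys_add[of p q]
    eval_mpoly_superset[of "Poly_Mapping.keys p \<union> Poly_Mapping.keys q" p x]
    eval_mpoly_superset[of "Poly_Mapping.keys p \<union> Poly_Mapping.keys q" q x]
    eval_mpoly_superset[of "Poly_Mapping.keys p \<union> Poly_Mapping.keys q" "p + q" x]
  by (simp add: lookup_add ring_distribs sum.distrib)

lemma eval_mpoly_sum: "eval_mpoly (sum f S) x = (\<Sum>i\<in>S. eval_mpoly (f i) x)"
  by (induction S rule: infinite_finite_induct) (auto simp: eval_mpoly_add)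

lemma eval_mpoly_diff: "eval_mpoly (p - q) x = eval_mpoly p x - eval_mpoly q x"
  using eval_mpoly_add[of "p - q" q x] by simp

lemma eval_mpoly_X [simp]: "eval_mpoly (X i) x = x $ i"
  by (simp add: eval_mpoly_def X_def)

lemma eval_mpoly_X_power2 [simp]: "eval_mpoly ((X i)\<^sup>2) x = (x $ i)\<^sup>2"
  by (simp add: eval_mpoly_def X_power2)

lemma sum_block_tail:
  "(\<Sum>I\<in>block_tail d h. f I) = (\<Sum>i=1..<d h. f (offset d h + i))" for f :: "nat \<Rightarrow> real"
proof -
  have "block_tail d h = {1 + offset d h ..< d h + offset d h}"
    by (auto simp: block_tail_def block_def)
  then show ?thesis
    using sum.shift_bounds_nat_ivl[of f 1 "offset d h" "d h"] by (simp add: add.commute)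
qed

lemma second_order_cone_block:
  assumes "d h \<ge> 1"
  shows "block_vec d h x \<in> second_order_cone (d h) \<longleftrightarrow>
    x $ offset d h \<ge> 0 \<and> (x $ offset d h)\<^sup>2 - (\<Sum>I\<in>block_tail d h. (x $ I)\<^sup>2) \<ge> 0"
proof -
  let ?s = "\<Sum>i=1..<d h. (x $ (offset d h + i))\<^sup>2"
  have s: "(\<Sum>i=1..<d h. (block_vec d h x $ i)\<^sup>2) = ?s" and s0: "?s \<ge> 0"
    by (auto simp: block_vec_def sum_nonneg)
  have "block_vec d h x \<in> second_order_cone (d h) \<longleftrightarrow> x $ offset d h \<ge> sqrt ?s"
    using assms unfolding second_order_cone_def mem_Collect_eq s by (auto simp: block_vec_def)
  also have "\<dots> \<longleftrightarrow> x $ offset d h \<ge> 0 \<and> (x $ offset d h)\<^sup>2 \<ge> ?s"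
    using s0 by (meson order_trans real_le_lsqrt real_sqrt_ge_zero sqrt_le_D)
  finally show ?thesis by (simp add: sum_block_tail)
qed

theorem K_prod_eq:
  assumes "\<And>h. h \<in> {2..N} \<Longrightarrow> d h \<ge> 1"
  shows "K_prod N d =
    {x \<in> carrier_vec (total_dim N d). \<forall>(\<phi>, m)\<in>K_polys N d. eval_mpoly \<phi> x \<ge> 0}"
proof -
  have polys: "(\<forall>(\<phi>, m)\<in>K_polys N d. eval_mpoly \<phi> x \<ge> 0) \<longleftrightarrow>
      (\<forall>I\<in>nonneg_idx N d. x $ I \<ge> 0) \<and>
      (\<forall>h\<in>{2..N}. (x $ offset d h)\<^sup>2 - (\<Sum>I\<in>block_tail d h. (x $ I)\<^sup>2) \<ge> 0)"
    (is "?L \<longleftrightarrow> ?R") for x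
  proof
    assume L: ?L
    have "x $ I \<ge> 0" if "I \<in> nonneg_idx N d" for I
      using bspec[OF L, of "(X I, 1)"] that by (auto simp: K_polys_def)
    moreover have "(x $ offset d h)\<^sup>2 - (\<Sum>I\<in>block_tail d h. (x $ I)\<^sup>2) \<ge> 0"
      if "h \<in> {2..N}" for h
      using bspec[OF L, of "((X (offset d h))\<^sup>2 - (\<Sum>I\<in>block_tail d h. (X I)\<^sup>2), 2)"] that
      by (auto simp: K_polys_def eval_mpoly_sum eval_mpoly_diff)
    ultimately show ?R by blast
  next
    assume ?R
    then show ?L
      by (auto simp: K_polys_def eval_mpoly_sum eval_mpoly_diff intro!: sum_nonneg)
  qed
  have blocks: "(\<forall>I\<in>nonneg_idx N d. x $ I \<ge> 0) \<and>
      (\<forall>h\<in>{2..N}. (x $ offset d h)\<^sup>2 - (\<Sum>I\<in>block_tail d h. (x $ I)\<^sup>2) \<ge> 0) \<longleftrightarrow>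
      block_vec d 1 x \<in> nonneg_orthant (d 1) \<and>
      (\<forall>h\<in>{2..N}. block_vec d h x \<in> second_order_cone (d h))" for x
  proof -
    have "block_vec d 1 x \<in> nonneg_orthant (d 1) \<longleftrightarrow> (\<forall>I\<in>block d 1. x $ I \<ge> 0)"
      by (auto simp: nonneg_orthant_def block_vec_def block_def)
    moreover have "block_vec d h x \<in> second_order_cone (d h) \<longleftrightarrow>
        x $ offset d h \<ge> 0 \<and> (x $ offset d h)\<^sup>2 - (\<Sum>I\<in>block_tail d h. (x $ I)\<^sup>2) \<ge> 0"
      if "h \<in> {2..N}" for h
      using assms[OF that] by (rule second_order_cone_block)
    ultimately show ?thesis unfolding nonneg_idx_def by (simp add: ball_Un) blast
  qed
  show ?thesis unfolding K_prod_def polys blocks ..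
qed

end

theory Submission
  imports Defs
begin

text \<open>
  Substituting \<open>x \<circ> x\<close> turns every generator of the ZVP cone into a sum of squares: a square stays a
  square, a product of nonnegative coordinates becomes a product of two sums of squares, and
  $x_{h1}^2 - \sum_I x_I^2$ becomes its own square. Dualising gives the inclusion.

  For strictness, take an orthant coordinate \<open>u\<close>, the head \<open>t\<close> of the first second-order cone and a
  tail coordinate \<open>w\<close> of it. The form $x_u (x_t + x_w)$ is in the NN cone, since its substitution is
  $x_u^2 ((x_t + x_w)^2 + \sum_J x_J^2)$ with \<open>J\<close> over the other indices of the block. It is
  separated from the ZVP cone by the functional $f \mapsto f(e_u - e_w) + f(e_t)$: although
  $e_u - e_w$ is outside the cone, every generator has a nonnegative sum of values at the two points.
\<close>

section \<open>Polynomials of low degree\<close>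

lemma lookup_scaleR [simp]:
  "Poly_Mapping.lookup (c *\<^sub>R p) k = c *\<^sub>R Poly_Mapping.lookup p k"
proof -
  have "finite {k. c *\<^sub>R Poly_Mapping.lookup p k \<noteq> 0}"
    by (rule finite_subset[OF _ finite_keys[of p]]) (auto simp: in_keys_iff)
  then show ?thesis
    by (simp add: scaleR_poly_mapping_def)
qed

text \<open>Writing a scalar as a constant polynomial makes the compatibility of scalar and ring
  multiplication a consequence of the ring laws.\<close>

lemma scaleR_eq_single_mult: "c *\<^sub>R p = Poly_Mapping.single 0 c * p" for p :: real_mpoly
proof -
  have "c *\<^sub>R p = Poly_Mapping.map ((*) c) p"
    by (rule poly_mapping_eqI) (simp add: map.rep_eq when_def)
  then show ?thesis
    by (simp add: mult_map_scale_conv_mult)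
qed

lemma mult_scaleR_left_mpoly [simp]: "(c *\<^sub>R p) * q = c *\<^sub>R (p * q)" for p q :: real_mpoly
  by (simp add: scaleR_eq_single_mult mult.assoc)

lemma mult_scaleR_right_mpoly [simp]: "p * (c *\<^sub>R q) = c *\<^sub>R (p * q)" for p q :: real_mpoly
  by (simp add: scaleR_eq_single_mult mult.left_commute)

lemma Hom_scaleR: "p \<in> Hom n m \<Longrightarrow> c *\<^sub>R p \<in> Hom n m"
  by (auto simp: Hom_def in_keys_iff)

lemma Hom_X_mult:
  assumes "i < n" "j < n"
  shows "X i * X j \<in> Hom n 2"
proof (cases "i = j")
  case True
  then show ?thesis
    using Hom_X_power2[OF assms(1)] by (simp add: power2_eq_square)
next
  case False
  let ?\<alpha> = "Poly_Mapping.single i 1 + Poly_Mapping.single j (1::nat)"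
  have keys: "Poly_Mapping.keys ?\<alpha> = {i, j}"
    by (auto simp: in_keys_iff lookup_add lookup_single when_def split: if_splits)
  have XX: "X i * X j = Poly_Mapping.single ?\<alpha> 1"
    by (simp add: X_def mult_single)
  have "(\<Sum>k\<in>{i, j}. Poly_Mapping.lookup ?\<alpha> k) = 2"
    using False by (simp add: lookup_add lookup_single when_def)
  then show ?thesis
    using assms keys by (simp add: Hom_def XX)
qed

text \<open>An exponent vector of degree 0 vanishes, since its entries on its keys are nonzero. A
  constant factor \<open>\<psi>\<^sup>2\<close> can therefore be treated as a nonnegative
  scalar.\<close>

lemma Hom_degree_0:
  assumes "\<psi> \<in> Hom n 0"
  shows "\<psi> = Poly_Mapping.single 0 (Poly_Mapping.lookup \<psi> 0)"
proof (rule poly_mapping_eqI)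
  fix \<alpha>
  have "\<alpha> = 0" if "\<alpha> \<in> Poly_Mapping.keys \<psi>"
    using assms that by (fastforce simp: Hom_def in_keys_iff intro: poly_mapping_eqI)
  then show "Poly_Mapping.lookup \<psi> \<alpha> =
      Poly_Mapping.lookup (Poly_Mapping.single 0 (Poly_Mapping.lookup \<psi> 0)) \<alpha>"
    by (auto simp: lookup_single when_def in_keys_iff)
qed

lemma exponent_of_degree_1:
  fixes \<alpha> :: "'a \<Rightarrow>\<^sub>0 nat"
  assumes "(\<Sum>i\<in>Poly_Mapping.keys \<alpha>. Poly_Mapping.lookup \<alpha> i) = 1"
  obtains i where "i \<in> Poly_Mapping.keys \<alpha>" "\<alpha> = Poly_Mapping.single i 1"
proof -
  obtain i where i: "i \<in> Poly_Mapping.keys \<alpha>" "Poly_Mapping.lookup \<alpha> i = 1"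
      "\<forall>j\<in>Poly_Mapping.keys \<alpha>. i \<noteq> j \<longrightarrow> Poly_Mapping.lookup \<alpha> j = 0"
    using assms unfolding sum_eq_1_iff[OF finite_keys] by blast
  then have "\<alpha> = Poly_Mapping.single i 1"
    by (intro poly_mapping_eqI) (auto simp: lookup_single when_def in_keys_iff)
  with i that show thesis by blast
qed

text \<open>Coefficients of a linear form are read off at the unit exponents; they give the vector
  \<open>a\<close> with which the square of the form is represented by
  \<open>sym_prod n a a\<close>.\<close>

lemma Hom_degree_1:
  assumes "\<psi> \<in> Hom n 1"
  shows "\<psi> = (\<Sum>i<n. Poly_Mapping.lookup \<psi> (Poly_Mapping.single i 1) *\<^sub>R X i)"
proof (rule poly_mapping_eqI)
  fix \<alpha>
  \<comment> \<open>Only a summand whose unit exponent equals \<open>\<alpha>\<close> survives, so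
    its coefficient may be replaced by the coefficient at \<open>\<alpha>\<close>.\<close>
  have rhs: "Poly_Mapping.lookup
      (\<Sum>i<n. Poly_Mapping.lookup \<psi> (Poly_Mapping.single i 1) *\<^sub>R X i) \<alpha> =
      (\<Sum>i<n. if Poly_Mapping.single i 1 = \<alpha> then Poly_Mapping.lookup \<psi> \<alpha> else 0)"
    unfolding lookup_sum by (rule sum.cong) (auto simp: X_def lookup_single when_def)
  show "Poly_Mapping.lookup \<psi> \<alpha> = Poly_Mapping.lookup
      (\<Sum>i<n. Poly_Mapping.lookup \<psi> (Poly_Mapping.single i 1) *\<^sub>R X i) \<alpha>"
  proof (cases "\<alpha> \<in> Poly_Mapping.keys \<psi>")
    case True
    then have "(\<Sum>i\<in>Poly_Mapping.keys \<alpha>. Poly_Mapping.lookup \<alpha> i) = 1"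
      and sub: "Poly_Mapping.keys \<alpha> \<subseteq> {..<n}"
      using assms by (auto simp: Hom_def)
    then obtain i where i: "i \<in> Poly_Mapping.keys \<alpha>" "\<alpha> = Poly_Mapping.single i 1"
      using exponent_of_degree_1 by blast
    have "Poly_Mapping.single k 1 = \<alpha> \<longleftrightarrow> k = i" for k
      unfolding i(2) by (metis lookup_single_eq lookup_single_not_eq zero_neq_one)
    moreover have "i < n"
      using i sub by auto
    ultimately show ?thesis
      unfolding rhs by simp
  next
    case False
    then have "Poly_Mapping.lookup \<psi> \<alpha> = 0"
      by (simp add: in_keys_iff)
    then show ?thesis
      unfolding rhs by (simp cong: if_cong)
  qed
qed


section \<open>Quadratic forms\<close>

text \<open>Averaging over both orders gives the symmetric matrix of a product of two linear forms,
  even when they differ.\<close>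

definition sym_prod :: "nat \<Rightarrow> (nat \<Rightarrow> real) \<Rightarrow> (nat \<Rightarrow> real) \<Rightarrow> real mat" where
  "sym_prod n a b = mat n n (\<lambda>(i, j). (a i * b j + a j * b i) / 2)"

definition lorentz :: "nat \<Rightarrow> nat \<Rightarrow> nat set \<Rightarrow> real mat" where
  "lorentz n t T = mat n n (\<lambda>(i, j). if i = j then of_bool (i = t) - of_bool (i \<in> T) else 0)"

text \<open>The numerical counterpart of \<open>quad_form\<close>, for evaluating the separating
  functional at real points.\<close>

definition quad_val :: "nat \<Rightarrow> real mat \<Rightarrow> (nat \<Rightarrow> real) \<Rightarrow> real" where
  "quad_val n A x = (\<Sum>i<n. \<Sum>j<n. A $$ (i, j) * (x i * x j))"

lemma sym_mats_sym_prod: "sym_prod n a b \<in> sym_mats n"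
  by (auto simp: sym_mats_def sym_prod_def algebra_simps)

lemma sym_mats_lorentz: "lorentz n t T \<in> sym_mats n"
  by (auto simp: sym_mats_def lorentz_def)

lemma sym_mats_add: "A \<in> sym_mats n \<Longrightarrow> B \<in> sym_mats n \<Longrightarrow> A + B \<in> sym_mats n"
  by (auto simp: sym_mats_def transpose_add)

lemma sym_mats_smult: "A \<in> sym_mats n \<Longrightarrow> c \<cdot>\<^sub>m A \<in> sym_mats n"
  by (auto simp: sym_mats_def intro!: eq_matI)
    (metis carrier_matD index_transpose_mat(1))

lemma sym_matsD: "A \<in> sym_mats n \<Longrightarrow> i < n \<Longrightarrow> j < n \<Longrightarrow> A $$ (i, j) = A $$ (j, i)"
  unfolding sym_mats_def by (metis (mono_tags, lifting) carrier_matD index_transpose_mat(1) mem_Collect_eq)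

lemma sym_mats_index_add [simp]:
  "B \<in> sym_mats n \<Longrightarrow> i < n \<Longrightarrow> j < n \<Longrightarrow> (A + B) $$ (i, j) = A $$ (i, j) + B $$ (i, j)"
  by (auto simp: sym_mats_def)

lemma sym_mats_index_smult [simp]:
  "A \<in> sym_mats n \<Longrightarrow> i < n \<Longrightarrow> j < n \<Longrightarrow> (c \<cdot>\<^sub>m A) $$ (i, j) = c * A $$ (i, j)"
  by (auto simp: sym_mats_def)

lemma quad_form_add:
  "A \<in> sym_mats n \<Longrightarrow> B \<in> sym_mats n \<Longrightarrow>
    quad_form n (A + B) v = quad_form n A v + quad_form n B v"
  by (simp add: quad_form_def scaleR_add_left sum.distrib cong: sum.cong_simp)

lemma quad_form_smult: "A \<in> sym_mats n \<Longrightarrow> quad_form n (c \<cdot>\<^sub>m A) v = c *\<^sub>R quad_form n A v"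
  by (simp add: quad_form_def scaleR_sum_right cong: sum.cong_simp)

text \<open>Exchanging the summation indices shows that both halves of the average agree. The vector
  \<open>v\<close> stays arbitrary because the identity serves both \<open>X\<close> and
  \<open>circ_sq N d\<close>.\<close>

lemma quad_form_sym_prod:
  "quad_form n (sym_prod n a b) v = (\<Sum>i<n. a i *\<^sub>R v i) * (\<Sum>j<n. b j *\<^sub>R v j)"
proof -
  let ?S = "\<Sum>i<n. \<Sum>j<n. (a i * b j) *\<^sub>R (v i * v j)"
  have S': "(\<Sum>i<n. \<Sum>j<n. (a j * b i) *\<^sub>R (v i * v j)) = ?S"
    by (subst sum.swap) (simp add: mult.commute)
  have "quad_form n (sym_prod n a b) v =
      (\<Sum>i<n. \<Sum>j<n. (1/2) *\<^sub>R ((a i * b j) *\<^sub>R (v i * v j) + (a j * b i) *\<^sub>R (v i * v j)))"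
    unfolding quad_form_def sym_prod_def
    by (intro sum.cong refl) (simp add: add_divide_distrib scaleR_add_left scaleR_add_right)
  also have "\<dots> = (1/2) *\<^sub>R (?S + ?S)"
    by (simp add: S' sum.distrib flip: scaleR_sum_right)
  also have "\<dots> = ?S"
    by (simp flip: scaleR_2)
  also have "\<dots> = (\<Sum>i<n. a i *\<^sub>R v i) * (\<Sum>j<n. b j *\<^sub>R v j)"
    by (simp add: sum_product mult.commute)
  finally show ?thesis .
qed

lemma quad_form_lorentz:
  assumes "t < n" "T \<subseteq> {..<n}"
  shows "quad_form n (lorentz n t T) v = (v t)\<^sup>2 - (\<Sum>i\<in>T. (v i)\<^sup>2)"
proof -
  have "quad_form n (lorentz n t T) v =
      (\<Sum>i<n. \<Sum>j<n. if i = j then (of_bool (i = t) - of_bool (i \<in> T)) *\<^sub>R (v i)\<^sup>2 else 0)"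
    unfolding quad_form_def lorentz_def
    by (intro sum.cong refl) (auto simp: power2_eq_square)
  also have "\<dots> = (\<Sum>i<n. (of_bool (i = t) - of_bool (i \<in> T)) *\<^sub>R (v i)\<^sup>2)"
    by simp
  also have "\<dots> = (\<Sum>i<n. if i = t then (v i)\<^sup>2 else 0) - (\<Sum>i<n. if i \<in> T then (v i)\<^sup>2 else 0)"
    unfolding sum_subtractf[symmetric] by (intro sum.cong refl) (auto simp: scaleR_diff_left)
  also have "\<dots> = (v t)\<^sup>2 - (\<Sum>i\<in>{..<n} \<inter> T. (v i)\<^sup>2)"
    using assms(1) by (simp add: sum.inter_restrict)
  finally show ?thesis
    using assms(2) by (simp add: Int_absorb1)
qed

lemma quad_val_add:
  "A \<in> sym_mats n \<Longrightarrow> B \<in> sym_mats n \<Longrightarrow>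
    quad_val n (A + B) x = quad_val n A x + quad_val n B x"
  by (simp add: quad_val_def distrib_right sum.distrib cong: sum.cong_simp)

lemma quad_val_smult: "A \<in> sym_mats n \<Longrightarrow> quad_val n (c \<cdot>\<^sub>m A) x = c * quad_val n A x"
  by (simp add: quad_val_def sum_distrib_left mult.assoc cong: sum.cong_simp)

lemma quad_val_sym_prod:
  "quad_val n (sym_prod n a b) x = (\<Sum>i<n. a i * x i) * (\<Sum>j<n. b j * x j)"
proof -
  let ?S = "\<Sum>i<n. \<Sum>j<n. (a i * b j) * (x i * x j)"
  have S': "(\<Sum>i<n. \<Sum>j<n. (a j * b i) * (x i * x j)) = ?S"
    by (subst sum.swap) (simp add: mult.commute)
  have "quad_val n (sym_prod n a b) x =
      (\<Sum>i<n. \<Sum>j<n. ((a i * b j) * (x i * x j) + (a j * b i) * (x i * x j)) / 2)"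
    unfolding quad_val_def sym_prod_def
    by (intro sum.cong refl) (simp add: field_simps)
  also have "\<dots> = (?S + ?S) / 2"
    by (simp only: S' sum.distrib flip: sum_divide_distrib)
  also have "\<dots> = (\<Sum>i<n. a i * x i) * (\<Sum>j<n. b j * x j)"
    by (simp add: sum_product mult_ac)
  finally show ?thesis .
qed

lemma quad_val_lorentz:
  assumes "t < n" "T \<subseteq> {..<n}"
  shows "quad_val n (lorentz n t T) x = (x t)\<^sup>2 - (\<Sum>i\<in>T. (x i)\<^sup>2)"
proof -
  have "quad_val n (lorentz n t T) x =
      (\<Sum>i<n. \<Sum>j<n. if i = j then (of_bool (i = t) - of_bool (i \<in> T)) * (x i)\<^sup>2 else 0)"
    unfolding quad_val_def lorentz_def
    by (intro sum.cong refl) (auto simp: power2_eq_square)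
  also have "\<dots> = (\<Sum>i<n. if i = t then (x i)\<^sup>2 else 0) - (\<Sum>i<n. if i \<in> T then (x i)\<^sup>2 else 0)"
    by (simp add: left_diff_distrib sum_subtractf of_bool_def if_distrib[of "\<lambda>c. c * _"] cong: if_cong)
  also have "\<dots> = (x t)\<^sup>2 - (\<Sum>i\<in>{..<n} \<inter> T. (x i)\<^sup>2)"
    using assms(1) by (simp add: sum.inter_restrict)
  finally show ?thesis
    using assms(2) by (simp add: Int_absorb1)
qed

text \<open>Pairing with a rank-one matrix is point evaluation, so sums of evaluations are
  candidates for elements of a dual cone.\<close>

lemma mat_inner_sym_prod_same: "mat_inner n (sym_prod n c c) B = quad_val n B c"
  unfolding mat_inner_def quad_val_def sym_prod_def
  by (intro sum.cong refl) (simp add: mult_ac)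

lemma mat_inner_add:
  "A \<in> sym_mats n \<Longrightarrow> A' \<in> sym_mats n \<Longrightarrow>
    mat_inner n (A + A') B = mat_inner n A B + mat_inner n A' B"
  by (simp add: mat_inner_def distrib_right sum.distrib cong: sum.cong_simp)

lemma single_add_single_eq_iff:
  "Poly_Mapping.single k 1 + Poly_Mapping.single l (1::nat) =
    Poly_Mapping.single i 1 + Poly_Mapping.single j 1 \<longleftrightarrow> k = i \<and> l = j \<or> k = j \<and> l = i"
  (is "?L = ?R \<longleftrightarrow> _")
proof
  assume eq: "?L = ?R"
  have "Poly_Mapping.lookup ?L x = Poly_Mapping.lookup ?R x" for x
    unfolding eq ..
  from this[of k] this[of l] this[of i] this[of j]
  show "k = i \<and> l = j \<or> k = j \<and> l = i"
    by (auto simp: lookup_add lookup_single when_def split: if_splits)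
qed (auto simp: add.commute)

text \<open>An off-diagonal monomial is produced by the positions (i, j) and (j, i), a diagonal one
  by a single position; hence the factor.\<close>

lemma lookup_quad_form_X:
  assumes "A \<in> sym_mats n" "i < n" "j < n"
  shows "Poly_Mapping.lookup (quad_form n A X) (Poly_Mapping.single i 1 + Poly_Mapping.single j 1) =
    (if i = j then 1 else 2) * A $$ (i, j)"
proof -
  have "Poly_Mapping.lookup (quad_form n A X) (Poly_Mapping.single i 1 + Poly_Mapping.single j 1) =
      (\<Sum>k<n. \<Sum>l<n. if k = i \<and> l = j \<or> k = j \<and> l = i then A $$ (i, j) else 0)"
    unfolding quad_form_def lookup_sum
  proof (intro sum.cong refl)
    fix k l assume "k \<in> {..<n}" "l \<in> {..<n}"
    then show "Poly_Mapping.lookup (A $$ (k, l) *\<^sub>R (X k * X l))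
        (Poly_Mapping.single i 1 + Poly_Mapping.single j 1) =
      (if k = i \<and> l = j \<or> k = j \<and> l = i then A $$ (i, j) else 0)"
      using sym_matsD[OF assms] single_add_single_eq_iff[of k l i j]
      by (auto simp: X_def mult_single lookup_single when_def)
  qed
  \<comment> \<open>The two positions are separated into two indicator sums; the second is switched
    off for \<open>i = j\<close>, where it would count the same position again.\<close>
  also have "\<dots> = (\<Sum>k<n. \<Sum>l<n. (if k = i then if l = j then A $$ (i, j) else 0 else 0) +
      (if i = j then 0 else if k = j then if l = i then A $$ (i, j) else 0 else 0))"
    by (intro sum.cong refl) auto
  also have "\<dots> = (\<Sum>k<n. (if k = i then A $$ (i, j) else 0) +
      (if i = j then 0 else if k = j then A $$ (i, j) else 0))"
    using assms by (intro sum.cong refl) (auto simp: sum.distrib)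
  also have "\<dots> = (if i = j then 1 else 2) * A $$ (i, j)"
    using assms by (auto simp: sum.distrib)
  finally show ?thesis .
qed

text \<open>This brings statements about polynomials back to matrices: \<open>K_ZVP0\<close> is
  defined through the polynomial of \<open>A\<close>, its dual through the entries of
  \<open>A\<close>.\<close>

lemma quad_form_X_inject:
  assumes "A \<in> sym_mats n" "B \<in> sym_mats n" "quad_form n A X = quad_form n B X"
  shows "A = B"
proof (rule eq_matI)
  fix i j assume "i < dim_row B" "j < dim_col B"
  then have "i < n" "j < n"
    using assms(2) by (auto simp: sym_mats_def)
  then show "A $$ (i, j) = B $$ (i, j)"
    using lookup_quad_form_X[OF assms(1), of i j] lookup_quad_form_X[OF assms(2), of i j] assms(3)
    by (auto split: if_splits)
qed (use assms in \<open>auto simp: sym_mats_def\<close>)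


section \<open>Sums of squares\<close>

text \<open>Squares absorb a nonnegative factor through its square root, so the convex hull is
  closed under arbitrary sums and nonnegative scaling.\<close>

lemma convex_cone_Sigma4: "convex_cone (Sigma4 n)"
proof -
  let ?S = "{\<theta>\<^sup>2 | \<theta>. \<theta> \<in> Hom n 2}"
  have "cone ?S"
    unfolding cone_def
  proof (intro ballI allI impI)
    fix p and c :: real assume "p \<in> ?S" "c \<ge> 0"
    then obtain \<theta> where "\<theta> \<in> Hom n 2" "p = \<theta>\<^sup>2" by blast
    moreover from this \<open>c \<ge> 0\<close> have "c *\<^sub>R p = (sqrt c *\<^sub>R \<theta>)\<^sup>2"
      by (simp add: power2_eq_square)
    ultimately show "c *\<^sub>R p \<in> ?S"
      using Hom_scaleR by blast
  qed
  then have "cone (Sigma4 n)"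
    unfolding Sigma4_def by (rule cone_convex_hull)
  moreover have "0 \<in> Sigma4 n"
    unfolding Sigma4_def by (rule hull_inc) (force intro: exI[of _ 0])
  ultimately show ?thesis
    using convex_cone[of "Sigma4 n"] by (simp add: convex_cone_iff Sigma4_def)
qed

lemma Sigma4_power2: "\<theta> \<in> Hom n 2 \<Longrightarrow> \<theta>\<^sup>2 \<in> Sigma4 n"
  unfolding Sigma4_def by (rule hull_inc) blast

lemma Sigma4_sum: "(\<And>i. i \<in> S \<Longrightarrow> f i \<in> Sigma4 n) \<Longrightarrow> sum f S \<in> Sigma4 n"
  by (induction S rule: infinite_finite_induct)
    (auto intro: convex_cone_add convex_cone_contains_0 convex_cone_Sigma4)

text \<open>Expanding the product gives squares of the quadratic monomials
  \<open>X i * X j\<close>.\<close>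

lemma Sigma4_mult_sum_squares:
  assumes "S \<subseteq> {..<n}" "T \<subseteq> {..<n}"
  shows "(\<Sum>i\<in>S. (X i)\<^sup>2) * (\<Sum>j\<in>T. (X j)\<^sup>2) \<in> Sigma4 n"
proof -
  have "(X i)\<^sup>2 * (X j)\<^sup>2 \<in> Sigma4 n" if "i \<in> S" "j \<in> T" for i j
    using that assms Sigma4_power2[OF Hom_X_mult, of i n j] by (auto simp: power_mult_distrib)
  then show ?thesis
    unfolding sum_product by (intro Sigma4_sum)
qed


section \<open>Comparison of the ZVP and NN cones\<close>

locale product_cone =
  fixes N :: nat and d :: "nat \<Rightarrow> nat"
  assumes N_pos: "N \<ge> 1"
    and d_pos: "\<And>h. h \<in> {2..N} \<Longrightarrow> d h \<ge> 1"
begin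

section \<open>A matrix cone containing the ZVP-type cone\<close>

abbreviation "n \<equiv> total_dim N d"

text \<open>Covers the single coordinates in \<open>nonneg_idx N d\<close> and their sum at
  once.\<close>

definition nonneg_coeffs :: "(nat \<Rightarrow> real) \<Rightarrow> bool" where
  "nonneg_coeffs a \<longleftrightarrow> (\<forall>i. a i \<ge> 0) \<and> (\<forall>i. i \<notin> nonneg_idx N d \<longrightarrow> a i = 0)"

text \<open>An upper bound for \<open>K_ZVP0 N d\<close>, given inductively so that both the
  substitution and the separating functional can be checked on generators.\<close>

inductive_set zvp_mats :: "real mat set" where
  square: "sym_prod n a a \<in> zvp_mats"
| product: "nonneg_coeffs a \<Longrightarrow> nonneg_coeffs b \<Longrightarrow> sym_prod n a b \<in> zvp_mats"
| lorentz: "h \<in> {2..N} \<Longrightarrow> lorentz n (offset d h) (block_tail d h) \<in> zvp_mats"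
| add: "A \<in> zvp_mats \<Longrightarrow> B \<in> zvp_mats \<Longrightarrow> A + B \<in> zvp_mats"
| smult: "c \<ge> 0 \<Longrightarrow> A \<in> zvp_mats \<Longrightarrow> c \<cdot>\<^sub>m A \<in> zvp_mats"

lemma zvp_mats_sym: "A \<in> zvp_mats \<Longrightarrow> A \<in> sym_mats n"
  by (induction rule: zvp_mats.induct)
    (auto intro: sym_mats_sym_prod sym_mats_lorentz sym_mats_add sym_mats_smult)

lemma nonneg_idx_less_n: "I \<in> nonneg_idx N d \<Longrightarrow> I < n"
  using nonneg_idx_less N_pos d_pos by blast

lemma offset_less: "h \<in> {2..N} \<Longrightarrow> offset d h < n"
  using nonneg_idx_less_n by (simp add: nonneg_idx_def)

lemma block_tail_subset: "h \<in> {2..N} \<Longrightarrow> block_tail d h \<subseteq> {..<n}"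
  using block_subset[of h N d] by (auto simp: block_tail_def)

text \<open>Each linear generator sums the coordinates over a subset of
  \<open>nonneg_idx N d\<close>, a singleton or everything; the coefficients are the indicator of
  that subset.\<close>

lemma degree_1_K_polys:
  assumes "(\<phi>, 1) \<in> K_polys N d"
  obtains a where "nonneg_coeffs a" "\<phi> = (\<Sum>i<n. a i *\<^sub>R X i)"
proof -
  have "\<exists>S \<subseteq> nonneg_idx N d. \<phi> = (\<Sum>i\<in>S. X i)"
  proof -
    consider I where "I \<in> nonneg_idx N d" "\<phi> = X I" | "\<phi> = (\<Sum>I\<in>nonneg_idx N d. X I)"
      using assms by (auto simp: K_polys_def)
    then show ?thesis
      by cases (auto intro: exI[of _ "{_}"])
  qed
  then obtain S where S: "S \<subseteq> nonneg_idx N d" "\<phi> = (\<Sum>i\<in>S. X i)" by blast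
  have "(\<Sum>i<n. of_bool (i \<in> S) *\<^sub>R X i) = (\<Sum>i\<in>{..<n} \<inter> S. X i)"
    by (simp add: sum.inter_restrict of_bool_def if_distrib[of "\<lambda>c. c *\<^sub>R _"] cong: if_cong)
  also have "{..<n} \<inter> S = S"
    using S(1) nonneg_idx_less_n by auto
  finally show thesis
    using that[of "\<lambda>i. of_bool (i \<in> S)"] S by (auto simp: nonneg_coeffs_def)
qed

lemma degree_2_K_polys:
  assumes "(\<phi>, 2) \<in> K_polys N d"
  obtains h where "h \<in> {2..N}" "\<phi> = (X (offset d h))\<^sup>2 - (\<Sum>I\<in>block_tail d h. (X I)\<^sup>2)"
  using assms by (auto simp: K_polys_def)

text \<open>Total degree 2 leaves three shapes: the square of a linear form, and a squared constant
  times either one quadratic generator or two linear ones.\<close>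

lemma E_generator_in_zvp:
  assumes ps: "set ps \<subseteq> K_polys N d" and deg: "sum_list (map snd ps) + 2 * e = 2"
    and \<psi>: "\<psi> \<in> Hom n e"
  shows "\<psi>\<^sup>2 * prod_list (map fst ps) \<in> (\<lambda>A. quad_form n A X) ` zvp_mats"
proof -
  have const: "\<psi>\<^sup>2 * quad_form n A X \<in> (\<lambda>A. quad_form n A X) ` zvp_mats"
    if A: "A \<in> zvp_mats" and "e = 0" for A
  proof -
    define c where "c = Poly_Mapping.lookup \<psi> 0"
    have "\<psi> = Poly_Mapping.single 0 c"
      using Hom_degree_0 \<psi> \<open>e = 0\<close> by (auto simp: c_def)
    then have "\<psi>\<^sup>2 * quad_form n A X = quad_form n (c\<^sup>2 \<cdot>\<^sub>m A) X"
      by (simp add: quad_form_smult zvp_mats_sym[OF A] scaleR_eq_single_mult mult_single power2_eq_square)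
    moreover have "c\<^sup>2 \<cdot>\<^sub>m A \<in> zvp_mats"
      by (intro zvp_mats.smult A) simp
    ultimately show ?thesis by blast
  qed
  have snd: "snd p \<in> {1, 2}" if "p \<in> set ps" for p
    using ps that by (auto simp: K_polys_def)
  consider (none) "ps = []" "e = 1"
    | (one) \<phi> where "ps = [(\<phi>, 2)]" "e = 0"
    | (two) \<phi>1 \<phi>2 where "ps = [(\<phi>1, 1), (\<phi>2, 1)]" "e = 0"
  proof (cases ps)
    case Nil
    then show ?thesis using deg none by simp
  next
    case (Cons p qs)
    show ?thesis
    proof (cases qs)
      case Nil
      \<comment> \<open>Parity excludes a single factor of degree 1.\<close>
      then have "snd p = 2" "e = 0" using snd[of p] deg Cons by auto
      then show ?thesis using one[of "fst p"] Cons Nil by (metis prod.collapse)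
    next
      case (Cons q rs)
      have "snd p \<ge> 1" "snd q \<ge> 1"
        using snd[of p] snd[of q] \<open>ps = p # qs\<close> Cons by auto
      moreover have "snd p + snd q + sum_list (map snd rs) + 2 * e = 2"
        using deg \<open>ps = p # qs\<close> Cons by simp
      ultimately have sums: "snd p = 1" "snd q = 1" "e = 0" "sum_list (map snd rs) = 0"
        by linarith+
      have "rs = []"
      proof (cases rs)
        case (Cons r rs')
        then have "snd r \<in> {1, 2}"
          using snd \<open>ps = p # qs\<close> \<open>qs = q # rs\<close> by auto
        then show ?thesis using sums(4) Cons by auto
      qed
      then show ?thesis
        using sums two[of "fst p" "fst q"] \<open>ps = p # qs\<close> Cons by (metis prod.collapse)
    qed
  qed
  then show ?thesis
  proof cases
    case none
    let ?a = "\<lambda>i. Poly_Mapping.lookup \<psi> (Poly_Mapping.single i 1)"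
    have "\<psi>\<^sup>2 = quad_form n (sym_prod n ?a ?a) X"
      using Hom_degree_1[of \<psi> n] \<psi> none by (simp add: quad_form_sym_prod power2_eq_square)
    then show ?thesis
      using none zvp_mats.square by auto
  next
    case one
    then obtain h where h: "h \<in> {2..N}"
        "\<phi> = (X (offset d h))\<^sup>2 - (\<Sum>I\<in>block_tail d h. (X I)\<^sup>2)"
      using ps degree_2_K_polys by auto
    then have "\<phi> = quad_form n (lorentz n (offset d h) (block_tail d h)) X"
      by (simp add: quad_form_lorentz offset_less block_tail_subset)
    then show ?thesis
      using const[OF zvp_mats.lorentz[OF h(1)]] one by simp
  next
    case two
    obtain a where a: "nonneg_coeffs a" "\<phi>1 = (\<Sum>i<n. a i *\<^sub>R X i)"
      using ps two degree_1_K_polys[of \<phi>1] by auto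
    obtain b where b: "nonneg_coeffs b" "\<phi>2 = (\<Sum>i<n. b i *\<^sub>R X i)"
      using ps two degree_1_K_polys[of \<phi>2] by auto
    have "\<phi>1 * \<phi>2 = quad_form n (sym_prod n a b) X"
      by (simp only: quad_form_sym_prod a b)
    then show ?thesis
      using const[OF zvp_mats.product[OF a(1) b(1)]] two by simp
  qed
qed

text \<open>Since \<open>quad_form\<close> is linear in the matrix, the polynomials of
  \<open>zvp_mats\<close> form a convex set, which contains the hull once it contains the
  generators. Injectivity then recovers the matrix.\<close>

lemma K_ZVP0_subset: "K_ZVP0 N d \<subseteq> zvp_mats"
proof
  fix A assume "A \<in> K_ZVP0 N d"
  then have A: "A \<in> sym_mats n" "quad_form n A X \<in> E_cone n 2 (K_polys N d)"
    by (auto simp: K_ZVP0_def)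
  have "convex ((\<lambda>A. quad_form n A X) ` zvp_mats)"
  proof (rule convexI)
    fix p q and u v :: real
    assume "p \<in> (\<lambda>A. quad_form n A X) ` zvp_mats" "q \<in> (\<lambda>A. quad_form n A X) ` zvp_mats"
      and uv: "0 \<le> u" "0 \<le> v"
    then obtain B C where BC: "B \<in> zvp_mats" "C \<in> zvp_mats"
        "p = quad_form n B X" "q = quad_form n C X" by blast
    then have "u *\<^sub>R p + v *\<^sub>R q = quad_form n (u \<cdot>\<^sub>m B + v \<cdot>\<^sub>m C) X"
      by (simp add: quad_form_add quad_form_smult sym_mats_smult zvp_mats_sym)
    then show "u *\<^sub>R p + v *\<^sub>R q \<in> (\<lambda>A. quad_form n A X) ` zvp_mats"
      using BC uv zvp_mats.add zvp_mats.smult by blast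
  qed
  then have "E_cone n 2 (K_polys N d) \<subseteq> (\<lambda>A. quad_form n A X) ` zvp_mats"
    unfolding E_cone_def by (intro hull_minimal subsetI) (blast intro: E_generator_in_zvp)
  then obtain B where "B \<in> zvp_mats" "quad_form n A X = quad_form n B X"
    using A by blast
  then show "A \<in> zvp_mats"
    using quad_form_X_inject[OF A(1) zvp_mats_sym] by metis
qed

section \<open>The substitution of \<open>x \<circ> x\<close>\<close>

lemma circ_sq_orthant: "I \<in> block d 1 \<Longrightarrow> circ_sq N d I = (X I)\<^sup>2"
  using block_of_eqI[of 1 N I d] N_pos by (simp add: circ_sq_def)

lemma circ_sq_head:
  assumes "h \<in> {2..N}"
  shows "circ_sq N d (offset d h) = (\<Sum>J\<in>block d h. (X J)\<^sup>2)"
  using block_of_eqI[of h N "offset d h" d] d_pos[OF assms] assms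
  by (simp add: circ_sq_def block_def)

lemma circ_sq_tail:
  assumes "h \<in> {2..N}" "I \<in> block_tail d h"
  shows "circ_sq N d I = 2 * X (offset d h) * X I"
  using block_of_eqI[of h N I d] assms by (simp add: circ_sq_def block_tail_def)

text \<open>The sum has one term for an orthant coordinate and runs over the whole block for a head.
  Products of nonnegative coordinates thus fall under
  \<open>Sigma4_mult_sum_squares\<close>.\<close>

lemma circ_sq_nonneg_idx:
  assumes "I \<in> nonneg_idx N d"
  obtains S where "S \<subseteq> {..<n}" "circ_sq N d I = (\<Sum>J\<in>S. (X J)\<^sup>2)"
proof (cases "I \<in> block d 1")
  case True
  then show ?thesis
    using that[of "{I}"] circ_sq_orthant nonneg_idx_less_n[OF assms] by simp
next
  case False
  then obtain h where "h \<in> {2..N}" "I = offset d h"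
    using assms by (auto simp: nonneg_idx_def)
  then show ?thesis
    using that[of "block d h"] circ_sq_head block_subset[of h N d] by simp
qed

lemma Hom_circ_sq:
  assumes "I < n"
  shows "circ_sq N d I \<in> Hom n 2"
proof (cases "I \<in> nonneg_idx N d")
  case True
  then obtain S where "S \<subseteq> {..<n}" "circ_sq N d I = (\<Sum>J\<in>S. (X J)\<^sup>2)"
    using circ_sq_nonneg_idx by blast
  then show ?thesis
    by (auto intro!: Hom_sum Hom_X_power2)
next
  case False
  \<comment> \<open>An index outside \<open>nonneg_idx N d\<close> is neither in the orthant block
    nor a head, so it is a tail index of some block.\<close>
  obtain h where h: "h \<in> {1..N}" "I \<in> block d h"
    using assms blocks_cover[of d N] by blast
  with False have "h \<noteq> 1"
    by (auto simp: nonneg_idx_def)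
  with h have h2: "h \<in> {2..N}"
    by simp
  with False h have h3: "I \<in> block_tail d h"
    by (auto simp: nonneg_idx_def block_tail_def)
  have "circ_sq N d I = 2 *\<^sub>R (X (offset d h) * X I)"
    using circ_sq_tail[OF h2 h3] by (simp add: scaleR_2 algebra_simps)
  then show ?thesis
    using Hom_X_mult[OF offset_less[OF h2] assms] Hom_scaleR by simp
qed

text \<open>With \<open>?t\<close> and \<open>?w\<close> as below, the head becomes
  \<open>?t + ?w\<close> and the squared tail entries sum to \<open>4 * ?t * ?w\<close>; the
  difference is the square of \<open>?t - ?w\<close>.\<close>

lemma lorentz_circ_sq:
  assumes h: "h \<in> {2..N}"
  shows "(circ_sq N d (offset d h))\<^sup>2 - (\<Sum>I\<in>block_tail d h. (circ_sq N d I)\<^sup>2) =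
    ((X (offset d h))\<^sup>2 - (\<Sum>I\<in>block_tail d h. (X I)\<^sup>2))\<^sup>2"
proof -
  let ?t = "(X (offset d h))\<^sup>2" and ?w = "\<Sum>I\<in>block_tail d h. (X I)\<^sup>2"
  have "block d h = insert (offset d h) (block_tail d h)" "offset d h \<notin> block_tail d h"
    using d_pos[OF h] by (auto simp: block_tail_def block_def)
  then have "circ_sq N d (offset d h) = ?t + ?w"
    by (simp add: circ_sq_head[OF h])
  moreover have "(\<Sum>I\<in>block_tail d h. (circ_sq N d I)\<^sup>2) = 4 * ?t * ?w"
    unfolding sum_distrib_left
    by (intro sum.cong refl) (simp add: circ_sq_tail[OF h] power_mult_distrib)
  ultimately show ?thesis
    by (simp add: power2_diff power2_sum)
qed

lemma zvp_mats_circ_sq: "A \<in> zvp_mats \<Longrightarrow> quad_form n A (circ_sq N d) \<in> Sigma4 n"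
proof (induction rule: zvp_mats.induct)
  case (square a)
  have "(\<Sum>i<n. a i *\<^sub>R circ_sq N d i)\<^sup>2 \<in> Sigma4 n"
    by (intro Sigma4_power2 Hom_sum Hom_scaleR Hom_circ_sq) simp
  then show ?case
    by (simp add: quad_form_sym_prod power2_eq_square)
next
  case (product a b)
  \<comment> \<open>The product of the two linear forms is handled term by term; a term with an
    index outside \<open>nonneg_idx N d\<close> has coefficient zero.\<close>
  have "(b j * a i) *\<^sub>R (circ_sq N d i * circ_sq N d j) \<in> Sigma4 n" for i j
  proof (cases "i \<in> nonneg_idx N d \<and> j \<in> nonneg_idx N d")
    case True
    then obtain S T where "S \<subseteq> {..<n}" "circ_sq N d i = (\<Sum>J\<in>S. (X J)\<^sup>2)"
        "T \<subseteq> {..<n}" "circ_sq N d j = (\<Sum>J\<in>T. (X J)\<^sup>2)"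
      using circ_sq_nonneg_idx by metis
    then show ?thesis
      using product by (auto simp: nonneg_coeffs_def
          intro!: convex_cone_scaleR convex_cone_Sigma4 Sigma4_mult_sum_squares)
  next
    case False
    then have "b j * a i = 0"
      using product by (auto simp: nonneg_coeffs_def)
    then show ?thesis
      by (simp only: scaleR_zero_left convex_cone_contains_0 convex_cone_Sigma4)
  qed
  then show ?case
    by (simp add: quad_form_sym_prod sum_product Sigma4_sum)
next
  case (lorentz h)
  have "(X (offset d h))\<^sup>2 - (\<Sum>I\<in>block_tail d h. (X I)\<^sup>2) \<in> Hom n 2"
    by (rule K_polys_Hom) (use N_pos d_pos lorentz in \<open>auto simp: K_polys_def\<close>)
  then show ?case
    using lorentz
    by (simp add: quad_form_lorentz offset_less block_tail_subset lorentz_circ_sq Sigma4_power2)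
next
  case (add A B)
  then show ?case
    by (simp add: quad_form_add zvp_mats_sym convex_cone_add convex_cone_Sigma4)
next
  case (smult c A)
  then show ?case
    by (simp add: quad_form_smult zvp_mats_sym convex_cone_scaleR convex_cone_Sigma4)
qed

theorem DNN_NN_subset_DNN_ZVP: "DNN_NN N d \<subseteq> DNN_ZVP N d"
proof -
  have "K_ZVP0 N d \<subseteq> K_NN0 N d"
    using K_ZVP0_subset zvp_mats_circ_sq zvp_mats_sym by (auto simp: K_NN0_def)
  then show ?thesis
    by (auto simp: DNN_NN_def DNN_ZVP_def dual_cone_def)
qed

section \<open>Strictness of the inclusion\<close>

lemma block_disjoint:
  "h \<in> {1..N} \<Longrightarrow> h' \<in> {1..N} \<Longrightarrow> I \<in> block d h \<Longrightarrow> I \<in> block d h' \<Longrightarrow> h = h'"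
  using block_of_eqI by metis

theorem DNN_NN_psubset_DNN_ZVP:
  assumes "N \<ge> 2" "d 1 \<ge> 1" "d 2 \<ge> 2"
  shows "DNN_NN N d \<subset> DNN_ZVP N d"
proof -
  \<comment> \<open>Position 0 is an orthant coordinate because \<open>d 1 \<ge> 1\<close>, and
    \<open>w\<close> is a tail position because \<open>d 2 \<ge> 2\<close>. The points are
    \<open>c\<close>, the difference of the unit vectors at 0 and \<open>w\<close>, and
    \<open>e\<close>, the unit vector at \<open>t\<close>; \<open>M\<close> sums the evaluations at
    both.\<close>
  define t where "t = offset d 2"
  define w where "w = t + 1"
  define c where "c = (\<lambda>i. of_bool (i = 0) - of_bool (i = w) :: real)"
  define e where "e = (\<lambda>i. of_bool (i = t) :: real)"
  define M where "M = sym_prod n c c + sym_prod n e e"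
  have two: "2 \<in> {2..N}" "2 \<in> {1..N}"
    using assms(1) by auto
  have t: "t = d 1"
    using offset_Suc[of 1 d] by (simp add: t_def numeral_2_eq_2)
  then have neq: "t \<noteq> 0" "w \<noteq> 0" "w \<noteq> t"
    using assms(2) by (auto simp: w_def)
  have block: "t \<in> block d 2" "w \<in> block d 2"
    using assms(3) by (auto simp: block_def t_def w_def)
  then have w_tail: "w \<in> block_tail d 2"
    using neq by (simp add: block_tail_def t_def)
  have less: "t < n" "w < n" "0 < n"
    using block block_subset[of 2 N d] assms(1) by auto
  have zero_block: "0 \<in> block d 1"
    using assms(2) by (simp add: block_def)
  \<comment> \<open>Hence linear forms with nonnegative coefficients do not see the negative entry
    of \<open>c\<close>.\<close>
  have w_not_nonneg: "w \<notin> nonneg_idx N d"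
  proof
    assume "w \<in> nonneg_idx N d"
    moreover have "w \<notin> block d 1"
      by (simp add: block_def w_def t)
    ultimately obtain h where h: "h \<in> {2..N}" "w = offset d h"
      by (auto simp: nonneg_idx_def)
    then have "w \<in> block d h"
      using d_pos[of h] by (simp add: block_def)
    then have "h = 2"
      using block_disjoint[of h 2 w] h two block by auto
    then show False
      using h neq by (simp add: t_def)
  qed
  have sum_c: "(\<Sum>i<n. a i * c i) = a 0 - a w" for a
    using less by (simp add: c_def of_bool_def right_diff_distrib sum_subtractf
        if_distrib[of "\<lambda>r. _ * r"] cong: if_cong)
  have sum_e: "(\<Sum>i<n. a i * e i) = a t" for a
    using less by (simp add: e_def of_bool_def if_distrib[of "\<lambda>r. _ * r"] cong: if_cong)
  have M_inner: "mat_inner n M B = quad_val n B c + quad_val n B e" for B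
    by (simp add: M_def mat_inner_add sym_mats_sym_prod mat_inner_sym_prod_same)
  have "mat_inner n M B \<ge> 0" if "B \<in> zvp_mats" for B
    using that unfolding M_inner
  proof (induction rule: zvp_mats.induct)
    case (square a)
    then show ?case
      by (simp add: quad_val_sym_prod)
  next
    case (product a b)
    then have "a w = 0" "b w = 0" "a 0 \<ge> 0" "b 0 \<ge> 0" "a t \<ge> 0" "b t \<ge> 0"
      using w_not_nonneg by (auto simp: nonneg_coeffs_def)
    then show ?case
      by (simp add: quad_val_sym_prod sum_c sum_e)
  next
    case (lorentz h)
    \<comment> \<open>Tail positions lie strictly above the offset of their block, and
      \<open>t\<close> is a head; so only \<open>w\<close> can contribute to the tail sums.\<close>
    have tail: "I \<noteq> 0 \<and> I \<noteq> t" if "I \<in> block_tail d h" for I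
    proof -
      have "I \<noteq> t"
      proof
        assume "I = t"
        then have "h = 2"
          using block_disjoint[of h 2 t] that lorentz two block by (auto simp: block_tail_def)
        then show False
          using that \<open>I = t\<close> by (simp add: block_tail_def t_def)
      qed
      then show ?thesis
        using that by (auto simp: block_tail_def block_def)
    qed
    have "(\<Sum>I\<in>block_tail d h. (c I)\<^sup>2) = (\<Sum>I\<in>block_tail d h. if I = w then 1 else 0)"
      by (rule sum.cong) (auto simp: c_def dest: tail)
    then have c_tail: "(\<Sum>I\<in>block_tail d h. (c I)\<^sup>2) = of_bool (w \<in> block_tail d h)"
      by simp
    have e_tail: "(\<Sum>I\<in>block_tail d h. (e I)\<^sup>2) = 0"
      by (rule sum.neutral) (auto simp: e_def dest: tail)
    \<comment> \<open>The value at \<open>c\<close> can be negative only in the block containing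
      \<open>w\<close>, where it is -1. The head of that block is \<open>t\<close>, so the value 1
      at \<open>e\<close> compensates.\<close>
    have "offset d h = t" if "w \<in> block_tail d h"
      using block_disjoint[of h 2 w] that lorentz two block by (auto simp: block_tail_def t_def)
    then have "(e (offset d h))\<^sup>2 \<ge> of_bool (w \<in> block_tail d h)"
      by (auto simp: e_def)
    moreover have "quad_val n (lorentz n (offset d h) (block_tail d h)) c +
        quad_val n (lorentz n (offset d h) (block_tail d h)) e =
        (c (offset d h))\<^sup>2 - of_bool (w \<in> block_tail d h) + (e (offset d h))\<^sup>2"
      using lorentz by (simp only: quad_val_lorentz offset_less block_tail_subset c_tail e_tail diff_zero)
    ultimately show ?case
      using zero_le_power2[of "c (offset d h)"] by linarith
  next
    case (add A B)
    then show ?case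
      by (simp add: quad_val_add zvp_mats_sym)
  next
    case (smult r A)
    then show ?case
      by (simp add: quad_val_smult zvp_mats_sym flip: distrib_left)
  qed
  then have M_in: "M \<in> DNN_ZVP N d"
    using K_ZVP0_subset
    by (auto simp: DNN_ZVP_def dual_cone_def M_def intro: sym_mats_add sym_mats_sym_prod)
  \<comment> \<open>The forms are \<open>x_0\<close> and \<open>x_t + x_w\<close>. Their product is
    -1 at \<open>c\<close>, and it is 0 at \<open>e\<close> because the first factor vanishes
    there.\<close>
  define a where "a = (\<lambda>i::nat. of_bool (i = 0) :: real)"
  define b where "b = (\<lambda>i. of_bool (i = t) + of_bool (i = w) :: real)"
  define A where "A = sym_prod n a b"
  have "mat_inner n M A = -1"
    using neq by (simp add: M_inner A_def quad_val_sym_prod sum_c sum_e a_def b_def)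
  moreover have "A \<in> K_NN0 N d"
  proof -
    let ?R = "block d 2 - {t, w}"
    have "block d 2 = insert t (insert w ?R)" "finite ?R"
      using block by (auto simp: block_def)
    then have "(\<Sum>J\<in>block d 2. (X J)\<^sup>2) = (\<Sum>J\<in>insert t (insert w ?R). (X J)\<^sup>2)"
      by simp
    also have "\<dots> = (X t)\<^sup>2 + ((X w)\<^sup>2 + (\<Sum>J\<in>?R. (X J)\<^sup>2))"
      using \<open>finite ?R\<close> neq by simp
    finally have "(\<Sum>J\<in>block d 2. (X J)\<^sup>2) = (X t)\<^sup>2 + ((X w)\<^sup>2 + (\<Sum>J\<in>?R. (X J)\<^sup>2))" .
    moreover have "(\<Sum>i<n. a i *\<^sub>R circ_sq N d i) = (X 0)\<^sup>2"
      using less circ_sq_orthant[OF zero_block]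
      by (simp add: a_def of_bool_def if_distrib[of "\<lambda>r. r *\<^sub>R _"] cong: if_cong)
    moreover have "(\<Sum>i<n. b i *\<^sub>R circ_sq N d i) = circ_sq N d t + circ_sq N d w"
      using less by (simp add: b_def of_bool_def scaleR_add_left sum.distrib
          if_distrib[of "\<lambda>r. r *\<^sub>R _"] cong: if_cong)
    \<comment> \<open>The cross term \<open>2 * X t * X w\<close> from the tail entry completes the
      square with the head. The square of \<open>X 0\<close> is written as a sum over a singleton to
      fit \<open>Sigma4_mult_sum_squares\<close>.\<close>
    ultimately have "quad_form n A (circ_sq N d) =
        (X 0 * X t + X 0 * X w)\<^sup>2 + (\<Sum>J\<in>{0}. (X J)\<^sup>2) * (\<Sum>J\<in>?R. (X J)\<^sup>2)"
      using circ_sq_head[OF two(1)] circ_sq_tail[OF two(1) w_tail]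
      by (simp add: A_def quad_form_sym_prod t_def power2_eq_square algebra_simps)
    also have "\<dots> \<in> Sigma4 n"
      using less block_subset[of 2 N d] assms(1)
      by (intro convex_cone_add[OF convex_cone_Sigma4] Sigma4_power2 Hom_add Hom_X_mult
          Sigma4_mult_sum_squares) auto
    finally show ?thesis
      by (simp add: K_NN0_def A_def sym_mats_sym_prod)
  qed
  ultimately have "M \<notin> DNN_NN N d"
    by (fastforce simp: DNN_NN_def dual_cone_def)
  then show ?thesis
    using M_in DNN_NN_subset_DNN_ZVP by blast
qed

end

theorem theorem4p9:
  fixes N :: nat and d :: "nat \<Rightarrow> nat"
  assumes "N \<ge> 1"
    and "\<And>h. h \<in> {2..N} \<Longrightarrow> d h \<ge> 1"
    and "total_dim N d \<ge> 1"
  shows "DNN_NN N d \<subseteq> DNN_ZVP N d \<and>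
    (N \<ge> 2 \<and> d 1 \<ge> 1 \<and> d 2 \<ge> 2 \<longrightarrow> DNN_NN N d \<subset> DNN_ZVP N d)"
proof -
  interpret product_cone N d
    using assms(1,2) by unfold_locales
  show ?thesis
    using DNN_NN_subset_DNN_ZVP DNN_NN_psubset_DNN_ZVP by blast
qed

end
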